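(* Let $n \ge 2$ and $A,B \in \mathbb{R}^{n \times n}$. Then every matrix in the interval hull $\mathbb{I}(A,B)$ is an almost $P$-matrix of the second category if and only if $I_u$ is an almost $P$-matrix of the second category and $I_z$ is an almost $P$-matrix of the second category for all $z \in \{\pm 1\}^n$.
   Context: For $A=(a_{ij}), B=(b_{ij}) \in \mathbb{R}^{n\times n}$, the interval hull is $\mathbb{I}(A,B) = \{C \in \mathbb{R}^{n\times n} : c_{ij} = t_{ij} a_{ij} + (1-t_{ij}) b_{ij},\ t_{ij} \in [0,1]\}$, where the $t_{ij}$ are chosen independently for each entry. Define the $n \times n$ matrices $(I_u)_{ij} = \max\{a_{ij},b_{ij}\}$, $(I_l)_{ij} = \min\{a_{ij},b_{ij}\}$, $I_c = \frac{A+B}{2}$, $\Delta = \frac{I_u - I_l}{2}$. For $z=(z_1,\dots,z_n) \in \{\pm 1\}^n$, let $D_z = \mathrm{diag}(z_1,\dots,z_n)$ and $I_z = I_c - D_z \Delta D_z$. A matrix $M \in \mathbb{R}^{n\times n}$ with $n \ge 2$ is an almost $P$-matrix if all its proper principal minors are positive and $\det M < 0$ (in particular $M$ is invertible). A real $n \times n$ matrix is an $N$-matrix if all its principal minors (including the determinant) are negative; an $N$-matrix is of the first category if it has at least one positive entry, and otherwise it is of the second category. An almost $P$-matrix $M$ is of the second category if $M^{-1}$ is an $N$-matrix of the second category. *)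

theory Defs
  imports
    Complex_Main
    "Jordan_Normal_Form.Determinant"
    "Jordan_Normal_Form.DL_Submatrix"
begin

definition interval_hull :: "nat \<Rightarrow> real mat \<Rightarrow> real mat \<Rightarrow> real mat set" where
  "interval_hull n A B = {C \<in> carrier_mat n n. \<exists>t :: nat \<Rightarrow> nat \<Rightarrow> real.
     \<forall>i<n. \<forall>j<n. t i j \<in> {0..1} \<and>
       C $$ (i, j) = t i j * A $$ (i, j) + (1 - t i j) * B $$ (i, j)}"

definition I_upper :: "nat \<Rightarrow> real mat \<Rightarrow> real mat \<Rightarrow> real mat" where
  "I_upper n A B = mat n n (\<lambda>(i, j). max (A $$ (i, j)) (B $$ (i, j)))"

definition I_lower :: "nat \<Rightarrow> real mat \<Rightarrow> real mat \<Rightarrow> real mat" where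
  "I_lower n A B = mat n n (\<lambda>(i, j). min (A $$ (i, j)) (B $$ (i, j)))"

definition I_center :: "real mat \<Rightarrow> real mat \<Rightarrow> real mat" where
  "I_center A B = (1 / 2) \<cdot>\<^sub>m (A + B)"

definition I_radius :: "nat \<Rightarrow> real mat \<Rightarrow> real mat \<Rightarrow> real mat" where
  "I_radius n A B = (1 / 2) \<cdot>\<^sub>m (I_upper n A B - I_lower n A B)"

definition sign_vecs :: "nat \<Rightarrow> real vec set" where
  "sign_vecs n = {z \<in> carrier_vec n. \<forall>i<n. z $ i \<in> {1, -1}}"

definition I_sign :: "nat \<Rightarrow> real mat \<Rightarrow> real mat \<Rightarrow> real vec \<Rightarrow> real mat" where
  "I_sign n A B z =
     (let D = mat_diag n (\<lambda>i. z $ i) in I_center A B - D * I_radius n A B * D)"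

definition principal_minor :: "real mat \<Rightarrow> nat set \<Rightarrow> real" where
  "principal_minor M S = det (submatrix M S S)"

text \<open>Principal minors are indexed by nonempty sets only: the determinant of the
  empty submatrix is 1, so no matrix would be an N-matrix otherwise.\<close>

definition almost_P_matrix :: "nat \<Rightarrow> real mat \<Rightarrow> bool" where
  "almost_P_matrix n M \<longleftrightarrow> n \<ge> 2 \<and> M \<in> carrier_mat n n \<and>
     (\<forall>S. S \<noteq> {} \<and> S \<subset> {..<n} \<longrightarrow> principal_minor M S > 0) \<and> det M < 0"

definition N_matrix :: "nat \<Rightarrow> real mat \<Rightarrow> bool" where
  "N_matrix n M \<longleftrightarrow> M \<in> carrier_mat n n \<and>
     (\<forall>S. S \<noteq> {} \<and> S \<subseteq> {..<n} \<longrightarrow> principal_minor M S < 0)"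

definition N_matrix_first_category :: "nat \<Rightarrow> real mat \<Rightarrow> bool" where
  "N_matrix_first_category n M \<longleftrightarrow> N_matrix n M \<and> (\<exists>i<n. \<exists>j<n. M $$ (i, j) > 0)"

definition N_matrix_second_category :: "nat \<Rightarrow> real mat \<Rightarrow> bool" where
  "N_matrix_second_category n M \<longleftrightarrow> N_matrix n M \<and> \<not> N_matrix_first_category n M"

definition almost_P_matrix_second_category :: "nat \<Rightarrow> real mat \<Rightarrow> bool" where
  "almost_P_matrix_second_category n M \<longleftrightarrow> almost_P_matrix n M \<and>
     (\<exists>M'. inverts_mat M M' \<and> inverts_mat M' M \<and> N_matrix_second_category n M')"

end

(* Since the inverse of an almost P-matrix is automatically an N-matrix (Jacobi's identity for
   complementary minors), the second category condition only says that the inverse is entrywise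
   nonpositive. The vertices I_l and I_u then play the role of the bounding matrices in Kuttler's
   theorem on intervals of inverse-nonnegative matrices (applied to the negatives): every matrix of
   the hull is nonsingular with nonpositive inverse, and its determinant is negative because the hull
   is connected. The proper principal minors are controlled by all the vertices I_z as in Rohn's
   theorem on interval P-matrices: a matrix with a nonpositive minor yields a sign-reversed vector,
   which is also reversed by the vertex belonging to its sign pattern. *)

theory Submission
  imports Defs
begin

section \<open>Principal minors as determinants of full-size matrices\<close>

text \<open>The determinant is the principal minor for \<open>S\<close>, but the size stays \<open>n\<close>, so that Jacobi's
  identity becomes a single matrix product.\<close>

definition restrict_rows :: "nat \<Rightarrow> nat set \<Rightarrow> 'a::comm_ring_1 mat \<Rightarrow> 'a mat" where
  "restrict_rows n S M = mat n n (\<lambda>(i, j). if i \<in> S then M $$ (i, j) else if i = j then 1 else 0)"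

lemma restrict_rows_carrier [simp]: "restrict_rows n S M \<in> carrier_mat n n"
  by (simp add: restrict_rows_def)

lemma restrict_rows_empty: "restrict_rows n {} M = 1\<^sub>m n"
  by (rule eq_matI) (auto simp: restrict_rows_def)

lemma bij_betw_pick:
  assumes "finite S"
  shows "bij_betw (pick S) {0..<card S} S"
proof -
  have inj: "inj_on (pick S) {0..<card S}"
    by (rule linorder_inj_onI) (auto dest: pick_mono_le)
  moreover have "pick S ` {0..<card S} \<subseteq> S"
    by (auto intro: pick_in_set_le)
  moreover have "card (pick S ` {0..<card S}) = card S"
    using card_image[OF inj] by simp
  ultimately show ?thesis
    using assms by (simp add: bij_betw_def card_subset_eq)
qed

text \<open>\<open>submatrix\<close> renumbers the indices in \<open>S\<close> by
  \<open>pick S\<close>. Transporting permutations along this bijection preserves their signs, so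
  the Leibniz formula can be summed over permutations of \<open>S\<close> itself.\<close>

lemma principal_minor_permutation_sum:
  assumes M: "M \<in> carrier_mat n n" and S: "S \<subseteq> {..<n}"
  shows "principal_minor M S = (\<Sum>p | p permutes S. of_int (sign p) * (\<Prod>i\<in>S. M $$ (i, p i)))"
proof -
  let ?k = "{0..<card S}"
  let ?f = "pick S"
  have fin: "finite S"
    using S finite_subset by blast
  have bij: "bij_betw ?f ?k S"
    using bij_betw_pick[OF fin] .
  hence inj: "inj_on ?f ?k" and im: "?f ` ?k = S"
    by (auto simp: bij_betw_def)
  have "{i. i < n \<and> i \<in> S} = S"
    using S by auto
  hence sub: "submatrix M S S = mat (card S) (card S) (\<lambda>(i, j). M $$ (?f i, ?f j))"
    using M by (simp add: submatrix_def)
  have "principal_minor M S =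
      (\<Sum>p | p permutes ?k. of_int (sign p) * (\<Prod>i\<in>?k. M $$ (?f i, ?f (p i))))"
    unfolding principal_minor_def sub
    by (subst det_def'[of _ "card S"])
       (auto intro!: sum.cong prod.cong simp: permutes_in_image dest: permutes_in_image)
  also have "\<dots> = (\<Sum>p | p permutes ?k. of_int (sign (map_permutation ?k ?f p)) *
      (\<Prod>i\<in>S. M $$ (i, map_permutation ?k ?f p i)))"
  proof (rule sum.cong[OF refl], clarsimp simp: sign_map_permutation[OF inj])
    fix p
    have "(\<Prod>i\<in>S. M $$ (i, map_permutation ?k ?f p i)) =
        (\<Prod>i\<in>?k. M $$ (?f i, map_permutation ?k ?f p (?f i)))"
      by (rule prod.reindex_bij_betw[OF bij, symmetric])
    thus "(\<Prod>i\<in>?k. M $$ (?f i, ?f (p i))) = (\<Prod>i\<in>S. M $$ (i, map_permutation ?k ?f p i))"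
      by (simp add: map_permutation_apply[OF inj])
  qed
  also have "\<dots> = (\<Sum>p | p permutes S. of_int (sign p) * (\<Prod>i\<in>S. M $$ (i, p i)))"
  proof -
    \<comment> \<open>This is the form in which \<open>bij_betw_permutations\<close> describes
      conjugation by \<open>?f\<close>.\<close>
    have "(\<lambda>\<pi> x. if x \<in> S then ?f (\<pi> (inv_into ?k ?f x)) else x) = map_permutation ?k ?f"
      by (auto simp: fun_eq_iff map_permutation_def restrict_id_def im)
    hence "bij_betw (map_permutation ?k ?f) {p. p permutes ?k} {p. p permutes S}"
      using bij_betw_permutations[OF bij] by simp
    thus ?thesis
      by (rule sum.reindex_bij_betw)
  qed
  finally show ?thesis .
qed

text \<open>In the Leibniz sum, a permutation that moves an index outside \<open>S\<close> picks up
  an off-diagonal zero of a unit row. The surviving permutations are those of \<open>S\<close>, and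
  for them the unit rows contribute only factors 1.\<close>

lemma principal_minor_eq_det_restrict_rows:
  assumes M: "M \<in> carrier_mat n n" and S: "S \<subseteq> {..<n}"
  shows "principal_minor M S = det (restrict_rows n S M)"
proof -
  let ?R = "restrict_rows n S M"
  have fin: "finite S"
    using S finite_subset by blast
  have zero: "(\<Prod>i = 0..<n. ?R $$ (i, p i)) = 0" if p: "p permutes {0..<n}" "\<not> p permutes S" for p
  proof -
    obtain i where i: "i \<notin> S" "p i \<noteq> i"
      using p permutes_superset[OF p(1), of S] by blast
    hence "i < n"
      using p(1) permutes_not_in[of p "{0..<n}" i] by (metis atLeastLessThan_iff zero_le)
    moreover from this have "p i < n"
      using permutes_in_image[OF p(1), of i] by auto
    ultimately have "?R $$ (i, p i) = 0"
      using i by (auto simp: restrict_rows_def)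
    with \<open>i < n\<close> show ?thesis
      by (intro prod_zero bexI[of _ i]) auto
  qed
  have "det ?R = (\<Sum>p | p permutes {0..<n}. of_int (sign p) * (\<Prod>i = 0..<n. ?R $$ (i, p i)))"
    by (rule det_def') simp
  also have "\<dots> = (\<Sum>p | p permutes S. of_int (sign p) * (\<Prod>i = 0..<n. ?R $$ (i, p i)))"
  proof (rule sum.mono_neutral_right)
    show "{p. p permutes S} \<subseteq> {p. p permutes {0..<n}}"
      using S by (auto intro: permutes_subset[of _ S] simp: atLeast0LessThan)
  qed (auto simp: finite_permutations zero)
  also have "\<dots> = (\<Sum>p | p permutes S. of_int (sign p) * (\<Prod>i\<in>S. M $$ (i, p i)))"
  proof (rule sum.cong[OF refl], clarsimp)
    fix p assume p: "p permutes S"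
    have "(\<Prod>i = 0..<n. ?R $$ (i, p i)) = (\<Prod>i\<in>S. ?R $$ (i, p i))"
      using S p by (intro prod.mono_neutral_right) (auto simp: restrict_rows_def permutes_not_in)
    also have "\<dots> = (\<Prod>i\<in>S. M $$ (i, p i))"
    proof (rule prod.cong[OF refl])
      fix i assume "i \<in> S"
      moreover from this have "p i \<in> S"
        using permutes_in_image[OF p] by simp
      ultimately show "?R $$ (i, p i) = M $$ (i, p i)"
        using S by (simp add: restrict_rows_def subset_iff)
    qed
    finally show "(\<Prod>i = 0..<n. ?R $$ (i, p i)) = (\<Prod>i\<in>S. M $$ (i, p i))" .
  qed
  finally show ?thesis
    using principal_minor_permutation_sum[OF assms] by simp
qed

section \<open>Entrywise products and Jacobi's identity for complementary minors\<close>

lemma index_mult_mat_sum: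
  assumes "A \<in> carrier_mat n m" "B \<in> carrier_mat m k" "i < n" "j < k"
  shows "(A * B) $$ (i, j) = (\<Sum>l<m. A $$ (i, l) * B $$ (l, j))"
  using assms by (auto simp: scalar_prod_def atLeast0LessThan intro!: sum.cong)

lemma index_mult_mat_vec_sum:
  assumes "A \<in> carrier_mat n m" "v \<in> carrier_vec m" "i < n"
  shows "(A *\<^sub>v v) $ i = (\<Sum>l<m. A $$ (i, l) * v $ l)"
  using assms by (auto simp: scalar_prod_def atLeast0LessThan intro!: sum.cong)

lemma sum_unit_left:
  fixes f :: "nat \<Rightarrow> 'a::comm_ring_1"
  assumes "i < n"
  shows "(\<Sum>l<n. (if i = l then 1 else 0) * f l) = f i"
  using assms by (simp add: if_distrib[of "\<lambda>x. x * _"] cong: if_cong)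

text \<open>Jacobi's identity. Multiplying by \<open>M\<close> turns the rows of \<open>M'\<close>
  kept in \<open>S\<close> into unit rows and the unit rows outside \<open>S\<close> into rows of
  \<open>M\<close>; taking determinants finishes the proof.\<close>

lemma det_restrict_rows_inverse:
  fixes M :: "'a::comm_ring_1 mat"
  assumes M: "M \<in> carrier_mat n n" "M' \<in> carrier_mat n n" and inv: "M' * M = 1\<^sub>m n"
  shows "det (restrict_rows n S M') * det M = det (restrict_rows n (- S) M)"
proof -
  have "restrict_rows n S M' * M = restrict_rows n (- S) M"
  proof (rule eq_matI)
    fix i j assume "i < dim_row (restrict_rows n (- S) M)" "j < dim_col (restrict_rows n (- S) M)"
    hence ij: "i < n" "j < n"
      by (simp_all add: restrict_rows_def)
    have "(restrict_rows n S M' * M) $$ (i, j) = (\<Sum>l<n. restrict_rows n S M' $$ (i, l) * M $$ (l, j))"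
      by (rule index_mult_mat_sum[OF _ M(1) ij]) simp
    also have "\<dots> = (if i \<in> S then (\<Sum>l<n. M' $$ (i, l) * M $$ (l, j)) else M $$ (i, j))"
      using ij sum_unit_left[of i n "\<lambda>l. M $$ (l, j)"] by (auto simp: restrict_rows_def)
    also have "(\<Sum>l<n. M' $$ (i, l) * M $$ (l, j)) = (1\<^sub>m n :: 'a mat) $$ (i, j)"
      using index_mult_mat_sum[OF M(2,1) ij] inv by simp
    finally show "(restrict_rows n S M' * M) $$ (i, j) = restrict_rows n (- S) M $$ (i, j)"
      using ij by (auto simp: restrict_rows_def)
  qed (use M in \<open>auto simp: restrict_rows_def\<close>)
  thus ?thesis
    by (metis M(1) det_mult restrict_rows_carrier)
qed

section \<open>Minors under nonnegative diagonal perturbations\<close>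

text \<open>Linearity of the determinant in row \<open>i\<close>: the cofactors along this row see
  only the other rows, which the three matrices share. In the application below, row
  \<open>i\<close> of \<open>E\<close> is a unit row.\<close>

lemma det_add_unit_row:
  fixes A :: "'a::comm_ring_1 mat"
  assumes carrier: "A \<in> carrier_mat n n" "B \<in> carrier_mat n n" "E \<in> carrier_mat n n" and i: "i < n"
    and other: "\<And>k j. k < n \<Longrightarrow> j < n \<Longrightarrow> k \<noteq> i \<Longrightarrow> A $$ (k, j) = B $$ (k, j) \<and> E $$ (k, j) = B $$ (k, j)"
    and row: "\<And>j. j < n \<Longrightarrow> A $$ (i, j) = B $$ (i, j) + d * E $$ (i, j)"
  shows "det A = det B + d * det E"
proof -
  have "mat_delete A i j = mat_delete B i j" "mat_delete E i j = mat_delete B i j" if "j < n" for j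
    using carrier i other that by (auto simp: mat_delete_def intro!: eq_matI)
  hence cof: "cofactor A i j = cofactor B i j" "cofactor E i j = cofactor B i j" if "j < n" for j
    using that by (simp_all add: cofactor_def)
  have "det A = (\<Sum>j<n. A $$ (i, j) * cofactor A i j)"
    by (rule laplace_expansion_row[OF carrier(1) i])
  also have "\<dots> = (\<Sum>j<n. B $$ (i, j) * cofactor B i j) + d * (\<Sum>j<n. E $$ (i, j) * cofactor E i j)"
    by (simp add: cof row algebra_simps sum.distrib sum_distrib_left)
  finally show ?thesis
    using laplace_expansion_row[OF carrier(2) i] laplace_expansion_row[OF carrier(3) i] by simp
qed

text \<open>The diagonal entries are raised one index at a time. Each increment contributes a
  nonnegative multiple of a smaller minor, so the induction has to carry positivity for all subsets
  of \<open>T\<close> at once.\<close>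

lemma det_restrict_rows_add_diag_pos:
  fixes M :: "real mat"
  assumes M: "M \<in> carrier_mat n n" and T: "T \<subseteq> {..<n}"
    and pos: "\<And>S. S \<subseteq> T \<Longrightarrow> det (restrict_rows n S M) > 0"
    and d: "\<And>i. d i \<ge> 0"
  shows "det (restrict_rows n T (M + mat_diag n d)) > 0"
proof -
  define N where "N V = M + mat_diag n (\<lambda>i. if i \<in> V then d i else 0)" for V
  have "finite V \<Longrightarrow> \<forall>S\<subseteq>T. det (restrict_rows n S (N V)) > 0" for V
  proof (induction V rule: finite_induct)
    case empty
    have "N {} = M"
      using M by (intro eq_matI) (auto simp: N_def mat_diag_def)
    with pos show ?case by simp
  next
    case (insert v V)
    show ?case
    proof (intro allI impI)
      fix S assume S: "S \<subseteq> T"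
      show "det (restrict_rows n S (N (insert v V))) > 0"
      proof (cases "v \<in> S")
        case False
        hence "restrict_rows n S (N (insert v V)) = restrict_rows n S (N V)"
          using M by (intro eq_matI) (auto simp: N_def mat_diag_def restrict_rows_def)
        with insert S show ?thesis by simp
      next
        case True
        \<comment> \<open>Passing to \<open>S - {v}\<close> replaces row \<open>v\<close> by the
          unit row along which the increment \<open>d v\<close> enters.\<close>
        have "det (restrict_rows n S (N (insert v V))) =
            det (restrict_rows n S (N V)) + d v * det (restrict_rows n (S - {v}) (N V))"
          by (rule det_add_unit_row[of _ n _ _ v])
             (use True insert T M S in \<open>auto simp: N_def mat_diag_def restrict_rows_def\<close>)
        moreover have "det (restrict_rows n S (N V)) > 0" "det (restrict_rows n (S - {v}) (N V)) > 0"
          using insert S by (auto simp: subset_trans[OF Diff_subset])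
        ultimately show ?thesis
          using d[of v] by (simp add: add_pos_nonneg)
      qed
    qed
  qed
  moreover have "finite T"
    using T finite_subset by blast
  \<comment> \<open>Diagonal entries outside \<open>T\<close> lie in discarded rows, so the finite
    set \<open>V = T\<close> suffices.\<close>
  moreover have "restrict_rows n T (N T) = restrict_rows n T (M + mat_diag n d)"
    using M by (intro eq_matI) (auto simp: N_def mat_diag_def restrict_rows_def)
  ultimately show ?thesis
    by (metis subset_refl)
qed

section \<open>Positive principal minors throughout an interval of matrices\<close>

lemma continuous_on_det_mat:
  fixes f :: "'b::topological_space \<Rightarrow> nat \<Rightarrow> nat \<Rightarrow> real"
  assumes "\<And>i j. i < n \<Longrightarrow> j < n \<Longrightarrow> continuous_on X (\<lambda>t. f t i j)"
  shows "continuous_on X (\<lambda>t. det (mat n n (\<lambda>(i, j). f t i j)))"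
proof -
  have "continuous_on X (\<lambda>t. \<Sum>p | p permutes {0..<n}. of_int (sign p) * (\<Prod>i = 0..<n. f t i (p i)))"
    using assms by (intro continuous_intros) (auto dest: permutes_in_image)
  moreover have "det (mat n n (\<lambda>(i, j). f t i j)) =
      (\<Sum>p | p permutes {0..<n}. of_int (sign p) * (\<Prod>i = 0..<n. f t i (p i)))" for t
    by (subst det_def'[of _ n]) (auto intro!: sum.cong prod.cong dest: permutes_in_image)
  ultimately show ?thesis by simp
qed


text \<open>These are the matrices \<open>I_sign\<close>, with a sign vector encoded as a predicate:
  only whether two signs agree matters, and no side condition on the entries of a vector has to be
  carried along.\<close>

definition vertex_mat :: "nat \<Rightarrow> 'a mat \<Rightarrow> 'a mat \<Rightarrow> (nat \<Rightarrow> bool) \<Rightarrow> 'a mat" where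
  "vertex_mat n L U z = mat n n (\<lambda>(i, j). if z i = z j then L $$ (i, j) else U $$ (i, j))"

lemma vertex_mat_carrier [simp]: "vertex_mat n L U z \<in> carrier_mat n n"
  by (simp add: vertex_mat_def)

text \<open>If the determinant were nonpositive, the segment to the identity would contain a singular
  matrix; a kernel vector \<open>x\<close> then satisfies \<open>x i * (C x) i \<le> 0\<close> for all \<open>i\<close>, and so does the vertex
  matrix of the sign pattern of \<open>x\<close>. Adding a nonnegative diagonal makes that vertex singular.\<close>

lemma interval_det_restrict_rows_pos:
  fixes L U C :: "real mat"
  assumes T: "T \<subseteq> {..<n}"
    and bounds: "\<And>i j. i < n \<Longrightarrow> j < n \<Longrightarrow> L $$ (i, j) \<le> C $$ (i, j) \<and> C $$ (i, j) \<le> U $$ (i, j)"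
    and vertices: "\<And>z S. S \<subseteq> T \<Longrightarrow> det (restrict_rows n S (vertex_mat n L U z)) > 0"
  shows "det (restrict_rows n T C) > 0"
proof (rule ccontr)
  assume neg: "\<not> det (restrict_rows n T C) > 0"
  define R where "R = restrict_rows n T C"
  define Q where "Q t = mat n n (\<lambda>(i, j). (1 - t) * R $$ (i, j) + t * (if i = j then 1 else 0))"
    for t :: real
  have "continuous_on {0..1} (\<lambda>t. det (Q t))"
    unfolding Q_def by (rule continuous_on_det_mat) (intro continuous_intros)
  moreover have "Q 0 = R" "Q 1 = 1\<^sub>m n"
    by (auto intro!: eq_matI simp: Q_def R_def restrict_rows_def)
  ultimately obtain t where t: "0 \<le> t" "t \<le> 1" "det (Q t) = 0"
    using IVT'[of "\<lambda>t. det (Q t)" 0 0 1] neg by (auto simp: R_def)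
  with \<open>Q 1 = 1\<^sub>m n\<close> have "t < 1"
    by (cases "t = 1") auto
  have "Q t \<in> carrier_mat n n"
    by (simp add: Q_def)
  with t(3) obtain x where x: "x \<in> carrier_vec n" "x \<noteq> 0\<^sub>v n" "Q t *\<^sub>v x = 0\<^sub>v n"
    using det_0_iff_vec_prod_zero by blast
  have Qx: "(1 - t) * (\<Sum>j<n. R $$ (i, j) * x $ j) + t * x $ i = 0" if i: "i < n" for i
  proof -
    have "0 = (\<Sum>j<n. Q t $$ (i, j) * x $ j)"
      using index_mult_mat_vec_sum[OF \<open>Q t \<in> carrier_mat n n\<close> x(1) i] x(3) i by simp
    also have "\<dots> = (\<Sum>j<n. (1 - t) * (R $$ (i, j) * x $ j) + t * ((if i = j then 1 else 0) * x $ j))"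
      using i by (intro sum.cong) (auto simp: Q_def algebra_simps)
    also have "\<dots> = (1 - t) * (\<Sum>j<n. R $$ (i, j) * x $ j) + t * x $ i"
      by (simp only: sum.distrib sum_distrib_left[symmetric] sum_unit_left[OF i])
    finally show ?thesis by simp
  qed
  \<comment> \<open>Outside \<open>T\<close> the row of \<open>R\<close> is a unit row, so the
    kernel equation reads (1 - t) x_i + t x_i = 0.\<close>
  have outside: "x $ i = 0" if i: "i < n" "i \<notin> T" for i
  proof -
    have "(\<Sum>j<n. R $$ (i, j) * x $ j) = (\<Sum>j<n. (if i = j then 1 else 0) * x $ j)"
      using i by (intro sum.cong) (auto simp: R_def restrict_rows_def)
    thus ?thesis
      using Qx[OF i(1)] sum_unit_left[OF i(1), of "\<lambda>j. x $ j"] by (simp add: algebra_simps)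
  qed
  \<comment> \<open>Zero entries count as positive; this is harmless because the products x_i x_j in
    which they occur vanish.\<close>
  define z where "z i \<longleftrightarrow> x $ i \<ge> 0" for i
  define V where "V = vertex_mat n L U z"
  define s where "s i = (\<Sum>j<n. V $$ (i, j) * x $ j)" for i
  have reversal: "x $ i * s i \<le> 0" if i: "i < n" for i
  proof (cases "i \<in> T")
    case False
    with outside i show ?thesis by simp
  next
    case True
    have "(\<Sum>j<n. R $$ (i, j) * x $ j) = (\<Sum>j<n. C $$ (i, j) * x $ j)"
      using i True by (intro sum.cong) (auto simp: R_def restrict_rows_def)
    hence "(1 - t) * (\<Sum>j<n. C $$ (i, j) * x $ j) = - t * x $ i"
      using Qx[OF i] by simp
    hence "(1 - t) * (x $ i * (\<Sum>j<n. C $$ (i, j) * x $ j)) = - t * (x $ i * x $ i)"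
      by (metis mult.assoc mult.commute)
    also have "\<dots> \<le> 0"
      using t by simp
    finally have "x $ i * (\<Sum>j<n. C $$ (i, j) * x $ j) \<le> 0"
      using \<open>t < 1\<close> by (simp add: mult_le_0_iff)
    \<comment> \<open>Among all matrices within the bounds, the vertex minimizes each term: it takes
      the lower bound where x_i x_j is nonnegative and the upper bound where it is
      nonpositive.\<close>
    moreover have "x $ i * s i \<le> x $ i * (\<Sum>j<n. C $$ (i, j) * x $ j)"
      unfolding s_def sum_distrib_left
    proof (rule sum_mono)
      fix j assume "j \<in> {..<n}"
      hence j: "j < n" by simp
      have "V $$ (i, j) * (x $ i * x $ j) \<le> C $$ (i, j) * (x $ i * x $ j)"
      proof (cases "z i = z j")
        case True
        hence "0 \<le> x $ i * x $ j"
          by (auto simp: z_def zero_le_mult_iff)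
        with True i j bounds[OF i j] show ?thesis
          by (auto simp: V_def vertex_mat_def intro: mult_right_mono)
      next
        case False
        hence "x $ i * x $ j \<le> 0"
          by (auto simp: z_def mult_le_0_iff)
        with False i j bounds[OF i j] show ?thesis
          by (auto simp: V_def vertex_mat_def intro: mult_right_mono_neg)
      qed
      thus "x $ i * (V $$ (i, j) * x $ j) \<le> x $ i * (C $$ (i, j) * x $ j)"
        by (simp add: algebra_simps)
    qed
    ultimately show ?thesis by simp
  qed
  define supp where "supp = {i. i < n \<and> x $ i \<noteq> 0}"
  \<comment> \<open>The value solves s_i + d_i x_i = 0, and it is nonnegative by
    \<open>reversal\<close>. Off the support the restricted matrix has a unit row and x_i = 0, so
    the default 0 does not disturb the kernel equation.\<close>
  define d where "d i = (if i \<in> supp then - s i / x $ i else 0)" for i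
  have "supp \<subseteq> T"
    using outside by (auto simp: supp_def)
  have d: "d i \<ge> 0" for i
    using reversal[of i] by (auto simp: d_def supp_def divide_le_0_iff mult_le_0_iff)
  have "det (restrict_rows n supp (V + mat_diag n d)) > 0"
    using \<open>supp \<subseteq> T\<close> T vertices d
    by (intro det_restrict_rows_add_diag_pos) (auto simp: V_def)
  moreover have "restrict_rows n supp (V + mat_diag n d) *\<^sub>v x = 0\<^sub>v n" (is "?W *\<^sub>v x = _")
  proof (rule eq_vecI)
    fix i assume "i < dim_vec (0\<^sub>v n :: real vec)"
    hence i: "i < n" by simp
    have W: "(?W *\<^sub>v x) $ i = (\<Sum>j<n. ?W $$ (i, j) * x $ j)"
      by (rule index_mult_mat_vec_sum[OF _ x(1) i]) simp
    show "(?W *\<^sub>v x) $ i = 0\<^sub>v n $ i"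
    proof (cases "i \<in> supp")
      case True
      have "(\<Sum>j<n. ?W $$ (i, j) * x $ j) =
          (\<Sum>j<n. V $$ (i, j) * x $ j + d i * ((if i = j then 1 else 0) * x $ j))"
        using i True
        by (intro sum.cong) (auto simp: restrict_rows_def mat_diag_def V_def algebra_simps)
      also have "\<dots> = s i + d i * x $ i"
        by (simp only: sum.distrib sum_distrib_left[symmetric] sum_unit_left[OF i] s_def)
      also have "\<dots> = 0"
        using True by (simp add: d_def supp_def)
      finally show ?thesis
        using W i by simp
    next
      case False
      have "(\<Sum>j<n. ?W $$ (i, j) * x $ j) = (\<Sum>j<n. (if i = j then 1 else 0) * x $ j)"
        using i False by (intro sum.cong) (auto simp: restrict_rows_def)
      thus ?thesis
        using W i False sum_unit_left[OF i, of "\<lambda>j. x $ j"] by (simp add: supp_def)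
    qed
  qed (simp add: restrict_rows_def)
  ultimately show False
    using det_0_iff_vec_prod_zero[of ?W n] x(1,2) by fastforce
qed

section \<open>Intervals of matrices with nonpositive inverse\<close>

definition nonpos_mat :: "nat \<Rightarrow> real mat \<Rightarrow> bool" where
  "nonpos_mat n M \<longleftrightarrow> M \<in> carrier_mat n n \<and> (\<forall>i<n. \<forall>j<n. M $$ (i, j) \<le> 0)"

text \<open>Up to the sign of the matrices, this is Kuttler's theorem on intervals of monotone matrices.
  With \<open>v = - U' 1 > 0\<close> one has \<open>C v \<le> U v = - 1\<close>, and \<open>L' C = I - L' (L - C)\<close> with
  \<open>L' (L - C) \<ge> 0\<close>; the minimum of \<open>x i / v i\<close> then cannot be negative.\<close>

lemma interval_monotone:
  fixes L U C L' U' :: "real mat"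
  assumes carrier: "L \<in> carrier_mat n n" "U \<in> carrier_mat n n"
    and bounds: "\<And>i j. i < n \<Longrightarrow> j < n \<Longrightarrow> L $$ (i, j) \<le> C $$ (i, j) \<and> C $$ (i, j) \<le> U $$ (i, j)"
    and inv: "L' * L = 1\<^sub>m n" "U * U' = 1\<^sub>m n"
    and nonpos: "nonpos_mat n L'" "nonpos_mat n U'"
    and diag: "\<And>i. i < n \<Longrightarrow> L' $$ (i, i) < 0" "\<And>i. i < n \<Longrightarrow> U' $$ (i, i) < 0"
    and x: "\<And>i. i < n \<Longrightarrow> (\<Sum>j<n. C $$ (i, j) * x j) \<le> 0"
    and i: "i < n"
  shows "x i \<ge> 0"
proof (rule ccontr)
  assume "\<not> x i \<ge> 0"
  define v where "v j = - (\<Sum>k<n. U' $$ (j, k))" for j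
  have carrier': "L' \<in> carrier_mat n n" "U' \<in> carrier_mat n n"
    and L'_nonpos: "\<And>i j. i < n \<Longrightarrow> j < n \<Longrightarrow> L' $$ (i, j) \<le> 0"
    and U'_nonpos: "\<And>i j. i < n \<Longrightarrow> j < n \<Longrightarrow> U' $$ (i, j) \<le> 0"
    using nonpos by (auto simp: nonpos_mat_def)
  have v_pos: "v j > 0" if j: "j < n" for j
  proof -
    have "(\<Sum>k<n. - U' $$ (j, k)) > 0"
      using diag(2)[OF j] U'_nonpos[OF j] j by (intro sum_pos2[of _ j]) auto
    thus ?thesis
      by (simp add: v_def sum_negf)
  qed
  have Cv: "(\<Sum>j<n. C $$ (k, j) * v j) \<le> - 1" if k: "k < n" for k
  proof -
    have "(\<Sum>j<n. C $$ (k, j) * v j) \<le> (\<Sum>j<n. U $$ (k, j) * v j)"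
      using bounds k v_pos by (intro sum_mono mult_right_mono) (auto intro: less_imp_le)
    also have "\<dots> = - (\<Sum>j<n. \<Sum>l<n. U $$ (k, j) * U' $$ (j, l))"
      by (simp add: v_def sum_negf sum_distrib_left)
    also have "\<dots> = - (\<Sum>l<n. \<Sum>j<n. U $$ (k, j) * U' $$ (j, l))"
      by (subst sum.swap) simp
    also have "\<dots> = - (\<Sum>l<n. (1\<^sub>m n :: real mat) $$ (k, l))"
      using index_mult_mat_sum[OF carrier(2) carrier'(2) k] inv(2) by simp
    also have "\<dots> = - 1"
      using k by (simp add: one_mat_def)
    finally show ?thesis .
  qed
  define m where "m = Min ((\<lambda>j. x j / v j) ` {..<n})"
  have "m \<in> (\<lambda>j. x j / v j) ` {..<n}"
    unfolding m_def using i by (intro Min_in) auto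
  then obtain k where k: "k < n" "m = x k / v k" by auto
  have m_le: "m \<le> x j / v j" if "j < n" for j
    unfolding m_def using that by (intro Min_le) auto
  have "m < 0"
    using m_le[OF i] v_pos[OF i] \<open>\<not> x i \<ge> 0\<close> by (smt (verit) divide_neg_pos)
  \<comment> \<open>Subtracting the minimal multiple of \<open>v\<close> leaves a nonnegative vector
    that vanishes at the minimizer \<open>k\<close>. Since \<open>m\<close> is negative and C v is
    at most -1, C w becomes strictly negative.\<close>
  define w where "w j = x j - m * v j" for j
  have w_nonneg: "w j \<ge> 0" if "j < n" for j
    using m_le[OF that] v_pos[OF that] by (simp add: w_def pos_le_divide_eq)
  have "w k = 0"
    using k v_pos[OF k(1)] by (simp add: w_def)
  have Cw: "(\<Sum>j<n. C $$ (l, j) * w j) < 0" if l: "l < n" for l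
  proof -
    have "(\<Sum>j<n. C $$ (l, j) * w j) = (\<Sum>j<n. C $$ (l, j) * x j) - m * (\<Sum>j<n. C $$ (l, j) * v j)"
      by (simp add: w_def algebra_simps sum_subtractf sum_distrib_left)
    moreover have "m * (\<Sum>j<n. C $$ (l, j) * v j) > 0"
      using \<open>m < 0\<close> Cv[OF l] by (intro mult_neg_neg) auto
    ultimately show ?thesis
      using x[OF l] by simp
  qed
  \<comment> \<open>The contradiction is 0 < (L' C w)_k \<le> (L' L w)_k = w_k = 0. The negative
    diagonal entry of \<open>L'\<close> makes the first inequality strict; the second uses L' \<le>
    0, L \<le> C and w \<ge> 0.\<close>
  have "0 < (\<Sum>l<n. L' $$ (k, l) * (\<Sum>j<n. C $$ (l, j) * w j))"
    using k(1) diag(1)[OF k(1)] L'_nonpos[OF k(1)] Cw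
    by (intro sum_pos2[of _ k]) (auto intro: mult_neg_neg mult_nonpos_nonpos less_imp_le)
  also have "\<dots> \<le> (\<Sum>l<n. L' $$ (k, l) * (\<Sum>j<n. L $$ (l, j) * w j))"
    using L'_nonpos k(1) bounds w_nonneg
    by (intro sum_mono mult_left_mono_neg) (auto intro: mult_right_mono)
  also have "\<dots> = (\<Sum>l<n. \<Sum>j<n. L' $$ (k, l) * L $$ (l, j) * w j)"
    by (simp add: sum_distrib_left mult.assoc)
  also have "\<dots> = (\<Sum>j<n. (\<Sum>l<n. L' $$ (k, l) * L $$ (l, j)) * w j)"
    by (subst sum.swap) (simp add: sum_distrib_right)
  also have "\<dots> = (\<Sum>j<n. (if k = j then 1 else 0) * w j)"
    using index_mult_mat_sum[OF carrier'(1) carrier(1) k(1)] inv(1) k(1)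
    by (intro sum.cong) auto
  also have "\<dots> = 0"
    using sum_unit_left[OF k(1), of w] \<open>w k = 0\<close> by simp
  finally show False by simp
qed

text \<open>A kernel vector and its negative both satisfy the hypothesis of
  \<open>interval_monotone\<close>, so all entries are zero.\<close>

lemma interval_det_nonzero:
  fixes L U C L' U' :: "real mat"
  assumes "L \<in> carrier_mat n n" "U \<in> carrier_mat n n" and C: "C \<in> carrier_mat n n"
    and "\<And>i j. i < n \<Longrightarrow> j < n \<Longrightarrow> L $$ (i, j) \<le> C $$ (i, j) \<and> C $$ (i, j) \<le> U $$ (i, j)"
    and "L' * L = 1\<^sub>m n" "U * U' = 1\<^sub>m n"
    and "nonpos_mat n L'" "nonpos_mat n U'"
    and "\<And>i. i < n \<Longrightarrow> L' $$ (i, i) < 0" "\<And>i. i < n \<Longrightarrow> U' $$ (i, i) < 0"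
  shows "det C \<noteq> 0"
proof
  assume "det C = 0"
  then obtain x where x: "x \<in> carrier_vec n" "x \<noteq> 0\<^sub>v n" "C *\<^sub>v x = 0\<^sub>v n"
    using det_0_iff_vec_prod_zero[OF C] by blast
  have Cx: "(\<Sum>j<n. C $$ (i, j) * x $ j) = 0" if "i < n" for i
    using index_mult_mat_vec_sum[OF C x(1) that] x(3) that by simp
  have "x $ i = 0" if "i < n" for i
    using interval_monotone[OF assms(1,2,4-10), of "\<lambda>j. x $ j" i]
      interval_monotone[OF assms(1,2,4-10), of "\<lambda>j. - x $ j" i] Cx that
    by (simp add: sum_negf)
  hence "x = 0\<^sub>v n"
    using x(1) by (intro eq_vecI) auto
  with x(2) show False by simp
qed

text \<open>The segment from \<open>C\<close> to \<open>U\<close> stays within the bounds, where the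
  determinant cannot vanish; hence its sign is the one at \<open>U\<close>.\<close>

lemma interval_det_neg:
  fixes L U C L' U' :: "real mat"
  assumes "L \<in> carrier_mat n n" and U: "U \<in> carrier_mat n n" and C: "C \<in> carrier_mat n n"
    and bounds: "\<And>i j. i < n \<Longrightarrow> j < n \<Longrightarrow> L $$ (i, j) \<le> C $$ (i, j) \<and> C $$ (i, j) \<le> U $$ (i, j)"
    and "L' * L = 1\<^sub>m n" "U * U' = 1\<^sub>m n"
    and "nonpos_mat n L'" "nonpos_mat n U'"
    and "\<And>i. i < n \<Longrightarrow> L' $$ (i, i) < 0" "\<And>i. i < n \<Longrightarrow> U' $$ (i, i) < 0"
    and "det U < 0"
  shows "det C < 0"
proof (rule ccontr)
  assume neg: "\<not> det C < 0"
  define Q where "Q t = mat n n (\<lambda>(i, j). (1 - t) * C $$ (i, j) + t * U $$ (i, j))" for t :: real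
  have "continuous_on {0..1} (\<lambda>t. det (Q t))"
    unfolding Q_def by (rule continuous_on_det_mat) (intro continuous_intros)
  moreover have "Q 0 = C" "Q 1 = U"
    using C U by (auto intro!: eq_matI simp: Q_def)
  ultimately obtain t where t: "0 \<le> t" "t \<le> 1" "det (Q t) = 0"
    using IVT2'[of "\<lambda>t. det (Q t)" 1 0 0] neg \<open>det U < 0\<close> by auto
  have "L $$ (i, j) \<le> Q t $$ (i, j) \<and> Q t $$ (i, j) \<le> U $$ (i, j)" if ij: "i < n" "j < n" for i j
  proof -
    have "C $$ (i, j) \<le> (1 - t) * C $$ (i, j) + t * U $$ (i, j)"
      using bounds[OF ij] t mult_left_mono[of "C $$ (i, j)" "U $$ (i, j)" t]
      by (simp add: algebra_simps)
    moreover have "(1 - t) * C $$ (i, j) + t * U $$ (i, j) \<le> U $$ (i, j)"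
      using bounds[OF ij] t mult_left_mono[of "C $$ (i, j)" "U $$ (i, j)" "1 - t"]
      by (simp add: algebra_simps)
    ultimately show ?thesis
      using bounds[OF ij] ij by (simp add: Q_def)
  qed
  moreover have "Q t \<in> carrier_mat n n"
    by (simp add: Q_def)
  ultimately have "det (Q t) \<noteq> 0"
    using interval_det_nonzero[OF assms(1,2) _ _ assms(5-10)] by blast
  with t(3) show False by simp
qed

lemma obtain_inverse:
  fixes M :: "'a::field mat"
  assumes M: "M \<in> carrier_mat n n" and "det M \<noteq> 0"
  obtains M' where "M' \<in> carrier_mat n n" "M * M' = 1\<^sub>m n" "M' * M = 1\<^sub>m n"
proof
  let ?M' = "inverse (det M) \<cdot>\<^sub>m adj_mat M"
  note adj = adj_mat[OF M]
  show M': "?M' \<in> carrier_mat n n"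
    using adj(1) by simp
  show "M * ?M' = 1\<^sub>m n"
    using mult_smult_distrib[OF M adj(1)] adj(2) assms(2)
    by (auto intro!: eq_matI)
  thus "?M' * M = 1\<^sub>m n"
    using mat_mult_left_right_inverse[OF M M'] by simp
qed

text \<open>\<open>C\<close> maps the negated j-th column of \<open>C'\<close> to a negated unit
  vector, so \<open>interval_monotone\<close> applies to each column.\<close>

lemma interval_inverse_nonpos:
  fixes L U C L' U' C' :: "real mat"
  assumes "L \<in> carrier_mat n n" "U \<in> carrier_mat n n" and C: "C \<in> carrier_mat n n"
    and "\<And>i j. i < n \<Longrightarrow> j < n \<Longrightarrow> L $$ (i, j) \<le> C $$ (i, j) \<and> C $$ (i, j) \<le> U $$ (i, j)"
    and "L' * L = 1\<^sub>m n" "U * U' = 1\<^sub>m n"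
    and "nonpos_mat n L'" "nonpos_mat n U'"
    and "\<And>i. i < n \<Longrightarrow> L' $$ (i, i) < 0" "\<And>i. i < n \<Longrightarrow> U' $$ (i, i) < 0"
    and C': "C' \<in> carrier_mat n n" and inv: "C * C' = 1\<^sub>m n"
  shows "nonpos_mat n C'"
  unfolding nonpos_mat_def
proof (intro conjI allI impI)
  fix i j assume ij: "i < n" "j < n"
  have "(\<Sum>l<n. C $$ (k, l) * - C' $$ (l, j)) \<le> 0" if "k < n" for k
    using index_mult_mat_sum[OF C C' that ij(2)] inv that ij(2)
    by (simp add: sum_negf) (metis order_refl zero_le_one)
  hence "- C' $$ (i, j) \<ge> 0"
    using interval_monotone[OF assms(1,2,4-10) _ ij(1), of "\<lambda>l. - C' $$ (l, j)"] by blast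
  thus "C' $$ (i, j) \<le> 0" by simp
qed (rule C')

section \<open>Almost P-matrices and the N-matrix property of their inverses\<close>

lemma almost_P_matrix_iff:
  assumes "M \<in> carrier_mat n n" "n \<ge> 2"
  shows "almost_P_matrix n M \<longleftrightarrow> (\<forall>S. S \<subset> {..<n} \<longrightarrow> det (restrict_rows n S M) > 0) \<and> det M < 0"
proof -
  have "principal_minor M S = det (restrict_rows n S M)" if "S \<subset> {..<n}" for S
    using principal_minor_eq_det_restrict_rows[OF assms(1)] that by blast
  moreover have "det (restrict_rows n {} M) > 0"
    by (simp add: restrict_rows_empty)
  ultimately have "(\<forall>S. S \<noteq> {} \<and> S \<subset> {..<n} \<longrightarrow> principal_minor M S > 0) \<longleftrightarrow>
      (\<forall>S. S \<subset> {..<n} \<longrightarrow> det (restrict_rows n S M) > 0)"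
    by metis
  thus ?thesis
    using assms by (simp add: almost_P_matrix_def)
qed

lemma almost_P_matrix_inverse_N_matrix:
  assumes P: "almost_P_matrix n M" and M': "M' \<in> carrier_mat n n" and inv: "M' * M = 1\<^sub>m n"
  shows "N_matrix n M'"
  unfolding N_matrix_def
proof (intro conjI allI impI)
  fix S assume S: "S \<noteq> {} \<and> S \<subseteq> {..<n}"
  have M: "M \<in> carrier_mat n n" "n \<ge> 2" "det M < 0"
    using P by (auto simp: almost_P_matrix_def)
  \<comment> \<open>\<open>- S\<close> is a complement in all natural numbers; only its part below
    \<open>n\<close> affects the rows. That part is a proper subset because \<open>S\<close> is
    nonempty.\<close>
  have "restrict_rows n (- S) M = restrict_rows n ({..<n} - S) M"
    by (auto simp: restrict_rows_def intro!: eq_matI)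
  moreover have "{..<n} - S \<subset> {..<n}"
    using S by auto
  ultimately have "det (restrict_rows n (- S) M) > 0"
    using P almost_P_matrix_iff[OF M(1,2)] by auto
  hence "det (restrict_rows n S M') * det M > 0"
    using det_restrict_rows_inverse[OF M(1) M' inv] by simp
  hence "det (restrict_rows n S M') < 0"
    using M(3) by (simp add: zero_less_mult_iff)
  thus "principal_minor M' S < 0"
    using principal_minor_eq_det_restrict_rows[OF M'] S by simp
qed (rule M')

text \<open>Supplies the strict diagonal signs on which \<open>interval_monotone\<close>
  depends.\<close>

lemma N_matrix_diag_neg:
  assumes "N_matrix n M" "i < n"
  shows "M $$ (i, i) < 0"
proof -
  have "principal_minor M {i} < 0"
    using assms by (auto simp: N_matrix_def)
  moreover have "principal_minor M {i} = M $$ (i, i)"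
    using assms by (subst principal_minor_permutation_sum[of _ n]) (auto simp: N_matrix_def)
  ultimately show ?thesis by simp
qed

lemma almost_P_matrix_second_category_iff:
  "almost_P_matrix_second_category n M \<longleftrightarrow>
    almost_P_matrix n M \<and> (\<exists>M'. nonpos_mat n M' \<and> M * M' = 1\<^sub>m n \<and> M' * M = 1\<^sub>m n)"
  (is "?lhs \<longleftrightarrow> ?rhs")
proof
  assume ?lhs
  then obtain M' where P: "almost_P_matrix n M" and inv: "inverts_mat M M'" "inverts_mat M' M"
    and M': "N_matrix_second_category n M'"
    unfolding almost_P_matrix_second_category_def by blast
  have carrier: "M \<in> carrier_mat n n" "M' \<in> carrier_mat n n"
    using P M' by (simp_all add: almost_P_matrix_def N_matrix_second_category_def N_matrix_def)
  moreover have "nonpos_mat n M'"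
    using M' carrier unfolding N_matrix_second_category_def N_matrix_first_category_def nonpos_mat_def
    by (meson not_less)
  ultimately show ?rhs
    using P inv by (auto simp: inverts_mat_def)
next
  assume ?rhs
  then obtain M' where P: "almost_P_matrix n M"
    and M': "nonpos_mat n M'" "M * M' = 1\<^sub>m n" "M' * M = 1\<^sub>m n"
    by blast
  have carrier: "M \<in> carrier_mat n n" "M' \<in> carrier_mat n n"
    using P M'(1) by (simp_all add: almost_P_matrix_def nonpos_mat_def)
  have "N_matrix n M'"
    by (rule almost_P_matrix_inverse_N_matrix[OF P carrier(2) M'(3)])
  hence "N_matrix_second_category n M'"
    using M'(1) unfolding N_matrix_second_category_def N_matrix_first_category_def nonpos_mat_def
    by (meson not_less)
  thus ?lhs
    using P M'(2,3) carrier unfolding almost_P_matrix_second_category_def inverts_mat_def by auto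
qed

section \<open>The hull as an entrywise interval, and its vertices\<close>

lemma convex_combination_iff_between:
  fixes a b c :: real
  shows "(\<exists>t\<in>{0..1}. c = t * a + (1 - t) * b) \<longleftrightarrow> min a b \<le> c \<and> c \<le> max a b"
proof
  assume "\<exists>t\<in>{0..1}. c = t * a + (1 - t) * b"
  then obtain t where t: "0 \<le> t" "t \<le> 1" "c = t * a + (1 - t) * b" by auto
  \<comment> \<open>\<open>convex_bound_le\<close> bounds from above, so the lower bound is obtained
    for the negated values.\<close>
  have "- (t * a + (1 - t) * b) \<le> - min a b"
    using convex_bound_le[of "- a" "- min a b" "- b" t "1 - t"] t by simp
  hence "min a b \<le> c"
    using t(3) by simp
  moreover have "c \<le> max a b"
    unfolding t(3) by (rule convex_bound_le) (use t in auto)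
  ultimately show "min a b \<le> c \<and> c \<le> max a b" by simp
next
  assume c: "min a b \<le> c \<and> c \<le> max a b"
  show "\<exists>t\<in>{0..1}. c = t * a + (1 - t) * b"
  proof (cases "a = b")
    case True
    with c show ?thesis by (intro bexI[of _ 0]) auto
  next
    case False
    define t where "t = (c - b) / (a - b)"
    have "t \<in> {0..1}"
      using c False by (auto simp: t_def divide_simps min_def max_def split: if_splits)
    moreover have "t * (a - b) = c - b"
      using False by (simp add: t_def)
    hence "c = t * a + (1 - t) * b"
      by (simp add: algebra_simps)
    ultimately show ?thesis by blast
  qed
qed

text \<open>The coefficients are independent for each entry, so by choice the existence of the
  function \<open>t\<close> reduces to a separate convex combination at every position.\<close>

lemma interval_hull_iff:
  "C \<in> interval_hull n A B \<longleftrightarrow> C \<in> carrier_mat n n \<and>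
    (\<forall>i<n. \<forall>j<n. I_lower n A B $$ (i, j) \<le> C $$ (i, j) \<and> C $$ (i, j) \<le> I_upper n A B $$ (i, j))"
proof -
  have "(\<exists>t :: nat \<Rightarrow> nat \<Rightarrow> real. \<forall>i<n. \<forall>j<n. t i j \<in> {0..1} \<and>
        C $$ (i, j) = t i j * A $$ (i, j) + (1 - t i j) * B $$ (i, j)) \<longleftrightarrow>
      (\<forall>i<n. \<forall>j<n. \<exists>t\<in>{0..1}. C $$ (i, j) = t * A $$ (i, j) + (1 - t) * B $$ (i, j))"
    (is "?lhs \<longleftrightarrow> ?rhs")
  proof
    assume ?rhs
    hence "\<forall>i j. \<exists>t. i < n \<longrightarrow> j < n \<longrightarrow> t \<in> {0..1} \<and>
        C $$ (i, j) = t * A $$ (i, j) + (1 - t) * B $$ (i, j)" by blast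
    thus ?lhs by metis
  qed blast
  thus ?thesis
    by (simp add: interval_hull_def convex_combination_iff_between I_lower_def I_upper_def)
qed

text \<open>Conjugation by the diagonal matrix multiplies entry (i, j) of the radius by z_i z_j. The
  center minus the radius is the minimum, and the center plus the radius is the maximum.\<close>

lemma I_sign_eq_vertex_mat:
  assumes A: "A \<in> carrier_mat n n" and B: "B \<in> carrier_mat n n" and z: "z \<in> sign_vecs n"
  shows "I_sign n A B z = vertex_mat n (I_lower n A B) (I_upper n A B) (\<lambda>i. z $ i = 1)"
proof -
  have R: "I_radius n A B \<in> carrier_mat n n"
    by (simp add: I_radius_def I_upper_def I_lower_def minus_carrier_mat)
  have D: "mat_diag n (\<lambda>i. z $ i) * I_radius n A B * mat_diag n (\<lambda>i. z $ i) =
      mat n n (\<lambda>(i, j). z $ i * I_radius n A B $$ (i, j) * z $ j)"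
    by (subst mat_diag_mult_left[OF R], subst mat_diag_mult_right[of _ n]) (auto intro!: eq_matI)
  have I: "I_sign n A B z =
      I_center A B - mat n n (\<lambda>(i, j). z $ i * I_radius n A B $$ (i, j) * z $ j)"
    unfolding I_sign_def Let_def D ..
  show ?thesis
  proof (rule eq_matI)
    fix i j
    assume "i < dim_row (vertex_mat n (I_lower n A B) (I_upper n A B) (\<lambda>i. z $ i = 1))"
      "j < dim_col (vertex_mat n (I_lower n A B) (I_upper n A B) (\<lambda>i. z $ i = 1))"
    hence ij: "i < n" "j < n"
      by (simp_all add: vertex_mat_def)
    hence "z $ i \<in> {1, -1}" "z $ j \<in> {1, -1}"
      using z by (auto simp: sign_vecs_def)
    moreover have "I_radius n A B $$ (i, j) = \<bar>A $$ (i, j) - B $$ (i, j)\<bar> / 2"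
      using ij by (simp add: I_radius_def I_upper_def I_lower_def max_def min_def)
    moreover have "I_center A B $$ (i, j) = (A $$ (i, j) + B $$ (i, j)) / 2"
      using ij A B by (simp add: I_center_def)
    ultimately show "I_sign n A B z $$ (i, j) =
        vertex_mat n (I_lower n A B) (I_upper n A B) (\<lambda>i. z $ i = 1) $$ (i, j)"
      using ij A B unfolding I
      by (auto simp: vertex_mat_def I_upper_def I_lower_def min_def max_def abs_if field_simps
        split: if_splits)
  qed (auto simp: I vertex_mat_def)
qed

lemma vertex_mat_eq_I_sign:
  assumes "A \<in> carrier_mat n n" "B \<in> carrier_mat n n"
  shows "\<exists>y\<in>sign_vecs n. I_sign n A B y = vertex_mat n (I_lower n A B) (I_upper n A B) z"
proof
  let ?y = "vec n (\<lambda>i. if z i then 1 else - 1) :: real vec"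
  show y: "?y \<in> sign_vecs n"
    by (simp add: sign_vecs_def)
  show "I_sign n A B ?y = vertex_mat n (I_lower n A B) (I_upper n A B) z"
    unfolding I_sign_eq_vertex_mat[OF assms y] by (auto simp: vertex_mat_def intro!: eq_matI)
qed

theorem theorem4p3:
  fixes n :: nat and A B :: "real mat"
  assumes "n \<ge> 2" and "A \<in> carrier_mat n n" and "B \<in> carrier_mat n n"
  shows "(\<forall>C \<in> interval_hull n A B. almost_P_matrix_second_category n C) \<longleftrightarrow>
    almost_P_matrix_second_category n (I_upper n A B) \<and>
    (\<forall>z \<in> sign_vecs n. almost_P_matrix_second_category n (I_sign n A B z))"
proof
  define L U where LU: "L = I_lower n A B" "U = I_upper n A B"
  have LU_carrier: "L \<in> carrier_mat n n" "U \<in> carrier_mat n n"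
    by (simp_all add: LU I_lower_def I_upper_def)
  have L_le_U: "L $$ (i, j) \<le> U $$ (i, j)" if "i < n" "j < n" for i j
    using that by (simp add: LU I_lower_def I_upper_def)
  {
    assume hull: "\<forall>C \<in> interval_hull n A B. almost_P_matrix_second_category n C"
    have "U \<in> interval_hull n A B"
      using L_le_U LU_carrier by (simp add: interval_hull_iff flip: LU)
    moreover have "I_sign n A B z \<in> interval_hull n A B" if "z \<in> sign_vecs n" for z
      using L_le_U by (simp add: I_sign_eq_vertex_mat[OF assms(2,3) that] interval_hull_iff
        vertex_mat_def flip: LU)
    ultimately show "almost_P_matrix_second_category n (I_upper n A B) \<and>
        (\<forall>z \<in> sign_vecs n. almost_P_matrix_second_category n (I_sign n A B z))"
      using hull by (simp add: LU)
  }
  assume rhs: "almost_P_matrix_second_category n (I_upper n A B) \<and>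
    (\<forall>z \<in> sign_vecs n. almost_P_matrix_second_category n (I_sign n A B z))"
  hence U: "almost_P_matrix_second_category n U"
    by (simp add: LU)
  have vertices: "almost_P_matrix_second_category n (vertex_mat n L U z)" for z
    using rhs vertex_mat_eq_I_sign[OF assms(2,3), of z] by (auto simp flip: LU)
  \<comment> \<open>The lower bound needs no hypothesis of its own: it is the vertex of a constant
    sign pattern.\<close>
  have "vertex_mat n L U (\<lambda>_. True) = L"
    using LU_carrier by (intro eq_matI) (auto simp: vertex_mat_def)
  with vertices have L: "almost_P_matrix_second_category n L"
    by metis
  from U obtain U' where U': "U * U' = 1\<^sub>m n" "U' * U = 1\<^sub>m n" "nonpos_mat n U'"
    by (auto simp: almost_P_matrix_second_category_iff)
  from L obtain L' where L': "L' * L = 1\<^sub>m n" "nonpos_mat n L'"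
    by (auto simp: almost_P_matrix_second_category_iff)
  have "N_matrix n L'" "N_matrix n U'"
    using L U L' U' almost_P_matrix_inverse_N_matrix
    unfolding almost_P_matrix_second_category_iff nonpos_mat_def by blast+
  hence diag: "L' $$ (i, i) < 0" "U' $$ (i, i) < 0" if "i < n" for i
    using that by (auto intro: N_matrix_diag_neg)
  have "det U < 0"
    using U by (simp add: almost_P_matrix_second_category_iff almost_P_matrix_def)
  show "\<forall>C \<in> interval_hull n A B. almost_P_matrix_second_category n C"
  proof
    fix C assume "C \<in> interval_hull n A B"
    hence C: "C \<in> carrier_mat n n"
      and bounds: "\<And>i j. i < n \<Longrightarrow> j < n \<Longrightarrow> L $$ (i, j) \<le> C $$ (i, j) \<and> C $$ (i, j) \<le> U $$ (i, j)"
      by (simp_all add: interval_hull_iff LU)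
    have "det C < 0"
      using interval_det_neg[OF LU_carrier C bounds L'(1) U'(1) L'(2) U'(3) diag \<open>det U < 0\<close>] .
    \<comment> \<open>All subsets of a proper subset are proper, so only the positive minors of the
      vertices enter, never their negative determinants.\<close>
    moreover have "det (restrict_rows n T C) > 0" if T: "T \<subset> {..<n}" for T
    proof (rule interval_det_restrict_rows_pos)
      fix z S assume "S \<subseteq> T"
      with T have "S \<subset> {..<n}" by blast
      thus "det (restrict_rows n S (vertex_mat n L U z)) > 0"
        using vertices[of z] almost_P_matrix_iff[of "vertex_mat n L U z" n] \<open>n \<ge> 2\<close>
        by (simp add: almost_P_matrix_second_category_iff)
    qed (use T bounds in auto)
    ultimately have P: "almost_P_matrix n C"
      using almost_P_matrix_iff[OF C \<open>n \<ge> 2\<close>] by simp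
    obtain C' where C': "C' \<in> carrier_mat n n" "C * C' = 1\<^sub>m n" "C' * C = 1\<^sub>m n"
      using obtain_inverse[OF C] \<open>det C < 0\<close> by auto
    have "nonpos_mat n C'"
      using interval_inverse_nonpos[OF LU_carrier C bounds L'(1) U'(1) L'(2) U'(3) diag C'(1,2)] .
    with P C' show "almost_P_matrix_second_category n C"
      by (auto simp: almost_P_matrix_second_category_iff)
  qed
qed

end
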